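(* Let $G$ be any finite simple graph on $n\geq 2$ vertices other than the path on $4$ vertices, and let $G^c$ be its complement. Then $\max\{i(G), i(G^c)\}\geq 1$.
   Context: For a graph $G=(V,E)$ and $X,Y\subseteq V$, $e_G(X,Y)$ denotes the set of edges of $G$ with one endpoint in $X$ and the other in $Y$. For $X\subseteq V$ write $\bar X=V\setminus X$ and $\partial_G(X)=e_G(X,\bar X)$. For a nonempty proper subset $X\subset V$, the isoperimetric number of $X$ is $i_G(X)=\frac{|\partial_G(X)|}{\min\{|X|,|\bar X|\}}$, and the isoperimetric number of $G$ is $i(G)=\min_{\emptyset\neq X\subsetneq V} i_G(X)$. The complement $G^c$ has vertex set $V$ and contains exactly the pairs of distinct vertices that are not edges of $G$. *)

theory Defs
  imports Complex_Main
begin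

text \<open>A graph is a pair of a vertex set and a set of edges, each edge being a two-element set of
  vertices.\<close>

type_synonym 'a graph = "'a set \<times> 'a set set"

abbreviation verts :: "'a graph \<Rightarrow> 'a set" where
  "verts G \<equiv> fst G"

abbreviation edges :: "'a graph \<Rightarrow> 'a set set" where
  "edges G \<equiv> snd G"

definition finite_simple_graph :: "'a graph \<Rightarrow> bool" where
  "finite_simple_graph G \<longleftrightarrow>
     finite (verts G) \<and> (\<forall>e\<in>edges G. e \<subseteq> verts G \<and> card e = 2)"

definition complement_graph :: "'a graph \<Rightarrow> 'a graph" where
  "complement_graph G =
     (verts G, {{u, v} | u v. u \<in> verts G \<and> v \<in> verts G \<and> u \<noteq> v \<and> {u, v} \<notin> edges G})"

definition graph_isomorphic :: "'a graph \<Rightarrow> 'b graph \<Rightarrow> bool" where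
  "graph_isomorphic G H \<longleftrightarrow>
     (\<exists>f. bij_betw f (verts G) (verts H) \<and>
        (\<forall>u\<in>verts G. \<forall>v\<in>verts G. {u, v} \<in> edges G \<longleftrightarrow> {f u, f v} \<in> edges H))"

definition path_graph :: "nat \<Rightarrow> nat graph" where
  "path_graph k = ({..<k}, {{i, Suc i} | i. Suc i < k})"

definition edges_between :: "'a graph \<Rightarrow> 'a set \<Rightarrow> 'a set \<Rightarrow> 'a set set" where
  "edges_between G X Y = {e \<in> edges G. \<exists>x\<in>X. \<exists>y\<in>Y. e = {x, y}}"

definition edge_boundary :: "'a graph \<Rightarrow> 'a set \<Rightarrow> 'a set set" where
  "edge_boundary G X = edges_between G X (verts G - X)"

definition isoperimetric_number_of :: "'a graph \<Rightarrow> 'a set \<Rightarrow> real" where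
  "isoperimetric_number_of G X =
     real (card (edge_boundary G X)) / real (min (card X) (card (verts G - X)))"

text \<open>The minimum is meaningful when the graph is finite with at least two vertices, so that the
  family of nonempty proper vertex subsets is finite and nonempty.\<close>

definition isoperimetric_number :: "'a graph \<Rightarrow> real" where
  "isoperimetric_number G =
     Min (isoperimetric_number_of G ` {X. X \<noteq> {} \<and> X \<subset> verts G})"

end

theory Submission
  imports Defs
begin

text \<open>Suppose X and Y have at most n/2 vertices and violate the bound in the graph and in its
  complement respectively. A pair of vertices separated by both cuts is an edge of one of the two
  graphs, so it is counted in one of the two boundaries. Writing a, b, c, d for the sizes of
  \<open>X \<inter> Y\<close>, \<open>X - Y\<close>, \<open>Y - X\<close> and the rest, this gives
  \<open>a d + b c \<le> (a + b - 1) + (a + c - 1)\<close>, which forces a = b = c = d = 1.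
  On four vertices the two boundary conditions leave only the path.\<close>

lemma edge_boundary_compl:
  assumes "X \<subseteq> verts G"
  shows "edge_boundary G (verts G - X) = edge_boundary G X"
proof -
  have "verts G - (verts G - X) = X" using assms by blast
  moreover have "edges_between G A B = edges_between G B A" for A B
    unfolding edges_between_def by (metis (no_types) insert_commute)
  ultimately show ?thesis unfolding edge_boundary_def by metis
qed

text \<open>The minimum is attained by some set. A set and its complement have the same boundary, so
  the witness can be taken to be the smaller side, whose size is the denominator of the
  ratio.\<close>

lemma isoperimetric_number_less_oneE:
  assumes fin: "finite (verts G)" and two: "card (verts G) \<ge> 2"
    and less: "isoperimetric_number G < 1"
  obtains X where "X \<subseteq> verts G" "card X \<le> card (verts G - X)"
    "card (edge_boundary G X) < card X"
proof -
  let ?F = "{X. X \<noteq> {} \<and> X \<subset> verts G}"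
  have finF: "finite ?F"
    by (rule finite_subset[of _ "Pow (verts G)"]) (use fin in auto)
  obtain v where v: "v \<in> verts G" using two by fastforce
  have "card {v} \<noteq> card (verts G)" using two by simp
  then have "{v} \<noteq> verts G" by metis
  with v have "{v} \<in> ?F" by auto
  then have "isoperimetric_number G \<in> isoperimetric_number_of G ` ?F"
    unfolding isoperimetric_number_def using finF by (intro Min_in) blast+
  then obtain X where "isoperimetric_number G = isoperimetric_number_of G X" "X \<in> ?F"
    by (rule imageE)
  with less have X: "X \<noteq> {}" "X \<subset> verts G" and i: "isoperimetric_number_of G X < 1"
    by simp_all
  have finX: "finite X" using X fin by (meson finite_subset psubset_imp_subset)
  \<comment> \<open>With both sides nonempty the denominator is positive, so the ratio is not the
    default value 0 of division by zero.\<close>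
  have "card X > 0" "card (verts G - X) > 0"
    using X fin finX by (auto simp: card_gt_0_iff)
  then have b: "card (edge_boundary G X) < min (card X) (card (verts G - X))"
    using i unfolding isoperimetric_number_of_def by (simp add: divide_less_eq split: if_splits)
  have dd: "verts G - (verts G - X) = X" using X by blast
  show thesis
  proof (cases "card X \<le> card (verts G - X)")
    case True
    then show thesis using that[of X] X b by auto
  next
    case False
    then show thesis
      using that[of "verts G - X"] X b dd edge_boundary_compl[of X G] by auto
  qed
qed

lemma finite_edge_boundary:
  assumes "finite (verts G)" "X \<subseteq> verts G"
  shows "finite (edge_boundary G X)"
  by (rule finite_subset[of _ "Pow (verts G)"])
    (use assms in \<open>auto simp: edge_boundary_def edges_between_def\<close>)

lemma edge_boundaryI:
  "\<lbrakk>{u, v} \<in> edges G; u \<in> X; v \<in> verts G; v \<notin> X\<rbrakk> \<Longrightarrow> {u, v} \<in> edge_boundary G X"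
  unfolding edge_boundary_def edges_between_def by blast

lemma verts_complement_graph [simp]: "verts (complement_graph G) = verts G"
  by (simp add: complement_graph_def)

lemma edges_complement_graphI:
  "\<lbrakk>u \<in> verts G; v \<in> verts G; u \<noteq> v; {u, v} \<notin> edges G\<rbrakk>
    \<Longrightarrow> {u, v} \<in> edges (complement_graph G)"
  unfolding complement_graph_def by auto

lemma card_crossing_pairs_le:
  assumes fin: "finite (verts G)" and X: "X \<subseteq> verts G" and Y: "Y \<subseteq> verts G"
  shows "card (X \<inter> Y) * card (verts G - X - Y) + card (X - Y) * card (Y - X)
    \<le> card (edge_boundary G X) + card (edge_boundary (complement_graph G) Y)"
proof -
  let ?P = "(X \<inter> Y) \<times> (verts G - X - Y)" and ?Q = "(X - Y) \<times> (Y - X)"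
  let ?B = "edge_boundary G X" and ?B' = "edge_boundary (complement_graph G) Y"
  let ?f = "\<lambda>(u, v). {u, v}"
  have finXY: "finite X" "finite Y" using fin X Y finite_subset by blast+
  \<comment> \<open>Every pair is oriented with its first component in \<open>X\<close> and its
    second outside, so the doubleton determines the pair.\<close>
  have "inj_on ?f (?P \<union> ?Q)"
    by (auto simp: inj_on_def doubleton_eq_iff)
  then have "card (?P \<union> ?Q) = card (?f ` (?P \<union> ?Q))" by (simp add: card_image)
  also have "\<dots> \<le> card (?B \<union> ?B')"
  proof (rule card_mono)
    show "finite (?B \<union> ?B')"
      using fin X Y by (simp add: finite_edge_boundary)
    have "{u, v} \<in> ?B \<union> ?B'" if "(u, v) \<in> ?P \<union> ?Q" for u v
    proof (cases "{u, v} \<in> edges G")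
      case True
      then have "{u, v} \<in> ?B" using that Y by (intro edge_boundaryI) auto
      then show ?thesis by simp
    next
      case False
      then have e: "{u, v} \<in> edges (complement_graph G)"
        using that X Y by (intro edges_complement_graphI) auto
      then have e': "{v, u} \<in> edges (complement_graph G)" by (simp add: insert_commute)
      \<comment> \<open>The endpoint in \<open>Y\<close> comes first in pairs from \<open>?P\<close>
        and second in pairs from \<open>?Q\<close>, hence the flipped form
        \<open>e'\<close>.\<close>
      show ?thesis
      proof (cases "u \<in> Y")
        case True
        then have "{u, v} \<in> ?B'" using that e by (intro edge_boundaryI) auto
        then show ?thesis by simp
      next
        case False
        then have "{v, u} \<in> ?B'" using that X e' by (intro edge_boundaryI) auto
        then show ?thesis by (simp add: insert_commute)
      qed
    qed
    then show "?f ` (?P \<union> ?Q) \<subseteq> ?B \<union> ?B'" by auto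
  qed
  also have "\<dots> \<le> card ?B + card ?B'" by (rule card_Un_le)
  finally have "card (?P \<union> ?Q) \<le> card ?B + card ?B'" .
  moreover have "card (?P \<union> ?Q) = card ?P + card ?Q"
    using fin finXY by (intro card_Un_disjoint) auto
  ultimately show ?thesis by (simp add: card_cartesian_product)
qed

text \<open>The count rearranges to \<open>(b - 1) * (c - 1) + a * (d - 2) \<le> -1\<close>, so one
  of the two products is negative. The size conditions add up to \<open>a \<le> d\<close>, which
  leaves little room for that. Integers avoid truncated subtraction.\<close>

lemma crossing_sizes_eq_one:
  fixes a b c d :: int
  assumes nonneg: "0 \<le> a" "0 \<le> b" "0 \<le> c" "0 \<le> d"
    and X: "a + b \<le> c + d" "1 \<le> a + b" and Y: "a + c \<le> b + d" "1 \<le> a + c"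
    and count: "a * d + b * c \<le> (a + b - 1) + (a + c - 1)"
  shows "a = 1 \<and> b = 1 \<and> c = 1 \<and> d = 1"
proof -
  have key: "(b - 1) * (c - 1) + a * (d - 2) \<le> -1"
    using count by (simp add: algebra_simps)
  have "a \<noteq> 0"
  proof
    assume "a = 0"
    \<comment> \<open>For \<open>a = 0\<close> nonemptiness of the two sets reads
      \<open>1 \<le> b\<close> and \<open>1 \<le> c\<close>.\<close>
    with X Y have "0 \<le> (b - 1) * (c - 1)" by simp
    with key \<open>a = 0\<close> show False by simp
  qed
  then have a1: "1 \<le> a" using nonneg by linarith
  have "d < 2"
  proof (rule ccontr)
    assume "\<not> d < 2"
    then have d2: "2 \<le> d" by simp
    have ge: "d - 2 \<le> a * (d - 2)" using a1 d2 mult_right_mono[of 1 a "d - 2"] by simp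
    have "b = 0 \<or> c = 0"
    proof (rule ccontr)
      assume "\<not> (b = 0 \<or> c = 0)"
      then have "0 \<le> (b - 1) * (c - 1)" using nonneg by simp
      with key ge d2 show False by linarith
    qed
    \<comment> \<open>Now \<open>key\<close> and \<open>ge\<close> give
      \<open>d \<le> b + c\<close>. If \<open>c = 0\<close>, then
      \<open>a + b \<le> d \<le> b\<close> contradicts \<open>1 \<le> a\<close>; the case
      \<open>b = 0\<close> is symmetric.\<close>
    then have "(b - 1) * (c - 1) = 1 - b - c" by auto
    with key ge a1 X Y \<open>b = 0 \<or> c = 0\<close> show False by linarith
  qed
  \<comment> \<open>From \<open>1 \<le> a \<le> d < 2\<close> both are 1, and the size conditions
    become \<open>b \<le> c\<close> and \<open>c \<le> b\<close>.\<close>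
  then have "d = 1" "a = 1" "b = c" using a1 X Y by linarith+
  with key have "(b - 1) * (b - 1) \<le> 0" by simp
  then have "b = 1" by (auto simp: mult_le_0_iff)
  with \<open>d = 1\<close> \<open>a = 1\<close> \<open>b = c\<close> show ?thesis by simp
qed

lemma edges_path_graph_4: "edges (path_graph 4) = {{0, 1}, {1, 2}, {2, 3}}"
proof -
  have "Suc i < 4 \<longleftrightarrow> i = 0 \<or> i = 1 \<or> i = 2" for i by auto
  then have "edges (path_graph 4) = {{i, Suc i} | i. i = 0 \<or> i = 1 \<or> i = 2}"
    unfolding path_graph_def by simp
  also have "\<dots> = {{0, 1}, {1, 2}, {2, 3}}"
    by (auto simp: numeral_2_eq_2 numeral_3_eq_3)
  finally show ?thesis .
qed

lemma graph_isomorphic_path_graph_4: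
  assumes G: "finite_simple_graph G" and V: "verts G = {p, q, r, s}" and d: "distinct [p, q, r, s]"
    and e: "{p, q} \<in> edges G" "{q, r} \<in> edges G" "{r, s} \<in> edges G"
    and n: "{p, r} \<notin> edges G" "{q, s} \<notin> edges G" "{p, s} \<notin> edges G"
  shows "graph_isomorphic G (path_graph 4)"
proof -
  define f :: "'a \<Rightarrow> nat" where
    "f x = (if x = p then 0 else if x = q then 1 else if x = r then 2 else 3)" for x
  have f: "f p = 0" "f q = 1" "f r = 2" "f s = 3" using d by (auto simp: f_def)
  \<comment> \<open>The isomorphism condition includes \<open>u = v\<close>, where
    \<open>{u, v}\<close> collapses to a singleton.\<close>
  have loop: "{x} \<notin> edges G" for x
    using G by (fastforce simp: finite_simple_graph_def)
  have "verts (path_graph 4) = {0, 1, 2, 3}"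
    by (auto simp: path_graph_def)
  then have "bij_betw f (verts G) (verts (path_graph 4))"
    using V d by (auto simp: bij_betw_def inj_on_def f)
  moreover have "\<forall>u\<in>verts G. \<forall>v\<in>verts G. {u, v} \<in> edges G \<longleftrightarrow> {f u, f v} \<in> edges (path_graph 4)"
    using e n loop unfolding V edges_path_graph_4
    by (simp add: f doubleton_eq_iff insert_commute)
  ultimately show ?thesis unfolding graph_isomorphic_def by blast
qed

lemma edge_boundary_le_oneD:
  assumes "finite (verts G)" "X \<subseteq> verts G" "card (edge_boundary G X) < 2"
    and "{u, v} \<in> edges G" "u \<in> X" "v \<in> verts G - X"
    and "{u', v'} \<in> edges G" "u' \<in> X" "v' \<in> verts G - X"
  shows "u = u' \<and> v = v'"
proof -
  have "{u, v} \<in> edge_boundary G X" "{u', v'} \<in> edge_boundary G X"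
    using assms by (auto intro: edge_boundaryI)
  then have "{u, v} = {u', v'}"
    using assms card_le_Suc0_iff_eq[OF finite_edge_boundary[OF assms(1,2)]] by auto
  then show ?thesis using assms by (auto simp: doubleton_eq_iff)
qed

text \<open>The pairs \<open>{p, s}\<close> and \<open>{q, r}\<close> cross both cuts, and each
  boundary has room for one edge, so exactly one of them is an edge of \<open>G\<close>. It uses up
  the first boundary, which makes \<open>{p, r}\<close> and \<open>{q, s}\<close> non-edges; the
  other pair uses up the boundary in the complement, which makes \<open>{p, q}\<close> and
  \<open>{r, s}\<close> edges.\<close>

lemma graph_isomorphic_path_if_small_boundaries:
  assumes G: "finite_simple_graph G" and V: "verts G = {p, q, r, s}" and d: "distinct [p, q, r, s]"
    and X: "card (edge_boundary G {p, q}) < 2"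
    and Y: "card (edge_boundary (complement_graph G) {p, r}) < 2"
  shows "graph_isomorphic G (path_graph 4)"
proof -
  let ?E = "edges G"
  have fin: "finite (verts G)" using V by simp
  have cut_G: "u = u' \<and> v = v'"
    if "{u, v} \<in> ?E" "{u', v'} \<in> ?E" "u \<in> {p, q}" "u' \<in> {p, q}" "v \<in> {r, s}" "v' \<in> {r, s}"
    for u v u' v'
    by (rule edge_boundary_le_oneD[OF fin _ X]) (use that V d in auto)
  have cut_C: "u = u' \<and> v = v'"
    if "{u, v} \<notin> ?E" "{u', v'} \<notin> ?E" "u \<in> {p, r}" "u' \<in> {p, r}" "v \<in> {q, s}" "v' \<in> {q, s}"
    for u v u' v'
  proof (rule edge_boundary_le_oneD[of "complement_graph G", OF _ _ Y])
    show "{u, v} \<in> edges (complement_graph G)" "{u', v'} \<in> edges (complement_graph G)"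
      by (rule edges_complement_graphI; use that V d in auto)+
  qed (use that V d fin in auto)
  have G1: "{p, s} \<notin> ?E \<or> {q, r} \<notin> ?E" and C1: "{p, s} \<in> ?E \<or> {q, r} \<in> ?E"
    using cut_G[of p s q r] cut_C[of p s r q] d by (auto simp: insert_commute)
  show ?thesis
  \<comment> \<open>The doubly crossing pair that is an edge becomes the middle edge of the path:
    \<open>q p s r\<close> in the first case, \<open>p q r s\<close> in the second.\<close>
  proof (cases "{p, s} \<in> ?E")
    case True
    then have qr: "{q, r} \<notin> ?E" using G1 by simp
    then have rq: "{r, q} \<notin> ?E" by (simp add: insert_commute)
    have "{p, r} \<notin> ?E" using cut_G[of p s p r] True d by auto
    moreover have "{q, s} \<notin> ?E" using cut_G[of p s q s] True d by auto
    moreover have "{p, q} \<in> ?E" using cut_C[of r q p q] rq d by auto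
    moreover have "{r, s} \<in> ?E" using cut_C[of r q r s] rq d by auto
    ultimately show ?thesis
      using G V d True qr by (intro graph_isomorphic_path_graph_4[of G q p s r]) (auto simp: insert_commute)
  next
    case False
    then have qr: "{q, r} \<in> ?E" using C1 by simp
    have "{p, r} \<notin> ?E" using cut_G[of q r p r] qr d by auto
    moreover have "{q, s} \<notin> ?E" using cut_G[of q r q s] qr d by auto
    moreover have "{p, q} \<in> ?E" using cut_C[of p s p q] False d by auto
    moreover have "{r, s} \<in> ?E" using cut_C[of p s r s] False d by auto
    ultimately show ?thesis
      using G V d False qr by (intro graph_isomorphic_path_graph_4[of G p q r s]) auto
  qed
qed

theorem theorem2p2:
  fixes G :: "'a graph"
  assumes "finite_simple_graph G"
    and "card (verts G) \<ge> 2"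
    and "\<not> graph_isomorphic G (path_graph 4)"
  shows "max (isoperimetric_number G) (isoperimetric_number (complement_graph G)) \<ge> 1"
proof (rule ccontr)
  let ?V = "verts G" and ?H = "complement_graph G"
  assume "\<not> ?thesis"
  then have less: "isoperimetric_number G < 1" "isoperimetric_number ?H < 1" by auto
  have fin: "finite ?V" using assms(1) by (simp add: finite_simple_graph_def)
  obtain X where X: "X \<subseteq> ?V" "card X \<le> card (?V - X)" "card (edge_boundary G X) < card X"
    using isoperimetric_number_less_oneE[OF fin assms(2) less(1)] by blast
  obtain Y where Y: "Y \<subseteq> ?V" "card Y \<le> card (?V - Y)" "card (edge_boundary ?H Y) < card Y"
    using isoperimetric_number_less_oneE[of ?H] fin assms(2) less(2) by auto
  let ?A = "X \<inter> Y" and ?B = "X - Y" and ?C = "Y - X" and ?D = "?V - X - Y"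
  have finXY: "finite X" "finite Y" using fin X(1) Y(1) finite_subset by blast+
  have cX: "card X = card ?A + card ?B" and cY: "card Y = card ?A + card ?C"
    using finXY by (simp_all add: card_Int_Diff Int_commute[of X Y])
      (metis card_Int_Diff Int_commute)
  have "(?V - X) \<inter> Y = ?C" "(?V - Y) \<inter> X = ?B" "?V - Y - X = ?D" using X(1) Y(1) by auto
  then have cVX: "card (?V - X) = card ?C + card ?D" and cVY: "card (?V - Y) = card ?B + card ?D"
    using card_Int_Diff[of "?V - X" Y] card_Int_Diff[of "?V - Y" X] fin by simp_all
  \<comment> \<open>Each boundary is strictly smaller than its set, which over \<open>int\<close>
    yields the two terms with \<open>- 1\<close>.\<close>
  have "int (card ?A) * int (card ?D) + int (card ?B) * int (card ?C)
      = int (card ?A * card ?D + card ?B * card ?C)" by simp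
  also have "\<dots> \<le> int (card (edge_boundary G X) + card (edge_boundary ?H Y))"
    using card_crossing_pairs_le[OF fin X(1) Y(1)] by linarith
  also have "\<dots> \<le> (int (card ?A) + int (card ?B) - 1) + (int (card ?A) + int (card ?C) - 1)"
    using X(3) Y(3) cX cY by linarith
  finally have "int (card ?A) = 1 \<and> int (card ?B) = 1 \<and> int (card ?C) = 1 \<and> int (card ?D) = 1"
    using X Y cX cY cVX cVY by (intro crossing_sizes_eq_one) linarith+
  then have one: "card ?A = 1" "card ?B = 1" "card ?C = 1" "card ?D = 1" by simp_all
  then obtain p q r s where ps: "?A = {p}" "?B = {q}" "?C = {r}" "?D = {s}"
    by (metis card_1_singletonE)
  have XY: "X = {p, q}" "Y = {p, r}" using ps by blast+
  have "?V = ?A \<union> ?B \<union> ?C \<union> ?D" using X(1) Y(1) by blast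
  then have V: "?V = {p, q, r, s}" unfolding ps by (simp add: insert_commute)
  have "p \<in> ?A" "q \<in> ?B" "r \<in> ?C" "s \<in> ?D" unfolding ps by simp_all
  then have "distinct [p, q, r, s]" by auto
  \<comment> \<open>Both sets have two elements, so the strict bounds \<open>X(3)\<close> and
    \<open>Y(3)\<close> say that each boundary has at most one edge.\<close>
  then have "graph_isomorphic G (path_graph 4)"
    using graph_isomorphic_path_if_small_boundaries[OF assms(1) V] X(3) Y(3) cX cY one XY by simp
  with assms(3) show False by contradiction
qed

end
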